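(* Fix a constant $c\in\mathbb{N}$. For partitions $\lambda,\mu,\pi$ with $|\lambda|=|\mu|=|\pi|$ and $\mathrm{ht}(\lambda),\mathrm{ht}(\mu),\mathrm{ht}(\pi)\le c$, whether $t^\lambda_{\mu,\pi}>0$ can be decided in polynomial time.
   Context: $\mathrm{ht}(\alpha)$ is the number of nonzero parts of $\alpha$, $\alpha^T$ its vector of column lengths. For finite $P\subseteq\mathbb{N}^3$ the marginals are $(x_P,y_P,z_P)$ with $x_P(i)$ the number of points of $P$ with $x$-coordinate $i$, etc.; $t^\lambda_{\mu,\pi}$ is the number of finite $P\subseteq\mathbb{N}^3$ with marginals $(\lambda^T,\mu^T,\pi^T)$. *)

theory Defs
  imports "HOL-Computational_Algebra.Polynomial"
begin

section \<open>Partitions and point sets with prescribed marginals\<close>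

text \<open>A partition is the list of its nonzero parts (trailing zeros are dropped).\<close>

definition is_partition :: "nat list \<Rightarrow> bool" where
  "is_partition xs \<longleftrightarrow> sorted_wrt (\<ge>) xs \<and> 0 \<notin> set xs"

definition ht :: "nat list \<Rightarrow> nat" where
  "ht xs = length (filter (\<lambda>k. k \<noteq> 0) xs)"

text \<open>Columns are numbered from 0, like the coordinates of the points, and the vector of column
  lengths is continued by zeros.\<close>

definition column_lengths :: "nat list \<Rightarrow> nat \<Rightarrow> nat" where
  "column_lengths xs i = card {j. j < length xs \<and> i < xs ! j}"

definition marginal_x :: "(nat \<times> nat \<times> nat) set \<Rightarrow> nat \<Rightarrow> nat" where
  "marginal_x P i = card {p \<in> P. fst p = i}"

definition marginal_y :: "(nat \<times> nat \<times> nat) set \<Rightarrow> nat \<Rightarrow> nat" where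
  "marginal_y P i = card {p \<in> P. fst (snd p) = i}"

definition marginal_z :: "(nat \<times> nat \<times> nat) set \<Rightarrow> nat \<Rightarrow> nat" where
  "marginal_z P i = card {p \<in> P. snd (snd p) = i}"

definition point_sets :: "nat list \<Rightarrow> nat list \<Rightarrow> nat list \<Rightarrow> (nat \<times> nat \<times> nat) set set" where
  "point_sets lam \<mu> \<pi> =
    {P. finite P \<and> marginal_x P = column_lengths lam \<and>
        marginal_y P = column_lengths \<mu> \<and> marginal_z P = column_lengths \<pi>}"

definition t_coeff :: "nat list \<Rightarrow> nat list \<Rightarrow> nat list \<Rightarrow> nat" where
  "t_coeff lam \<mu> \<pi> = card (point_sets lam \<mu> \<pi>)"

lemma column_lengths_neq_0D:
  assumes "column_lengths xs i \<noteq> 0"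
  shows "i < sum_list xs"
proof -
  have "{j. j < length xs \<and> i < xs ! j} \<noteq> {}"
    using assms unfolding column_lengths_def by (metis card.empty)
  then obtain j where "j < length xs" "i < xs ! j" by blast
  then show ?thesis using member_le_sum_list[of "xs ! j" xs] by simp
qed

text \<open>Hence the cardinality in \<open>t_coeff\<close> is a genuine count.\<close>

lemma finite_point_sets: "finite (point_sets lam \<mu> \<pi>)"
proof (rule finite_subset)
  let ?B = "{..<sum_list lam} \<times> {..<sum_list \<mu>} \<times> {..<sum_list \<pi>}"
  show "finite (Pow ?B)" by simp
  show "point_sets lam \<mu> \<pi> \<subseteq> Pow ?B"
  proof (intro subsetI PowI)
    fix P p assume P: "P \<in> point_sets lam \<mu> \<pi>" and p: "p \<in> P"
    have *: "card {q \<in> P. f q = f p} \<noteq> 0" for f :: "nat \<times> nat \<times> nat \<Rightarrow> nat"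
    proof -
      have "finite {q \<in> P. f q = f p}" using P by (simp add: point_sets_def)
      then show ?thesis using p by (auto simp only: card_eq_0_iff)
    qed
    have "marginal_x P (fst p) \<noteq> 0" "marginal_y P (fst (snd p)) \<noteq> 0"
      "marginal_z P (snd (snd p)) \<noteq> 0"
      using *[of fst] *[of "\<lambda>q. fst (snd q)"] *[of "\<lambda>q. snd (snd q)"]
      unfolding marginal_x_def marginal_y_def marginal_z_def by simp_all
    then have "column_lengths lam (fst p) \<noteq> 0" "column_lengths \<mu> (fst (snd p)) \<noteq> 0"
      "column_lengths \<pi> (snd (snd p)) \<noteq> 0"
      using P by (simp_all add: point_sets_def)
    then have "fst p < sum_list lam" "fst (snd p) < sum_list \<mu>" "snd (snd p) < sum_list \<pi>"
      by (simp_all add: column_lengths_neq_0D)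
    then show "p \<in> ?B" by (cases p) auto
  qed
qed


section \<open>Deterministic Turing machines and polynomial time\<close>

text \<open>Tape symbols over an input alphabet: the blank, the input letters, and a supply of work
  symbols, of which a machine uses finitely many.\<close>

datatype 'a tape_symbol = Blank | Letter 'a | Aux nat

datatype move = Move_Left | Stay | Move_Right

record 'a tm =
  states :: "nat set"
  alphabet :: "'a tape_symbol set"
  trans :: "nat \<Rightarrow> 'a tape_symbol \<Rightarrow> nat \<times> 'a tape_symbol \<times> move"
  start :: nat
  acc :: nat
  rej :: nat

definition turing_machine :: "'a::finite tm \<Rightarrow> bool" where
  "turing_machine M \<longleftrightarrow>
    finite (states M) \<and> finite (alphabet M) \<and>
    Blank \<in> alphabet M \<and> range Letter \<subseteq> alphabet M \<and>
    start M \<in> states M \<and> acc M \<in> states M \<and> rej M \<in> states M \<and> acc M \<noteq> rej M \<and>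
    (\<forall>q \<in> states M. \<forall>s \<in> alphabet M.
      case trans M q s of (q', s', _) \<Rightarrow> q' \<in> states M \<and> s' \<in> alphabet M)"

text \<open>A configuration consists of the state, the two-way infinite tape and the head position.\<close>

type_synonym 'a config = "nat \<times> (int \<Rightarrow> 'a tape_symbol) \<times> int"

fun shift :: "move \<Rightarrow> int \<Rightarrow> int" where
  "shift Move_Left h = h - 1"
| "shift Stay h = h"
| "shift Move_Right h = h + 1"

definition halting :: "'a tm \<Rightarrow> 'a config \<Rightarrow> bool" where
  "halting M C \<longleftrightarrow> fst C = acc M \<or> fst C = rej M"

definition step :: "'a tm \<Rightarrow> 'a config \<Rightarrow> 'a config" where
  "step M C =
    (if halting M C then C
     else case C of (q, tape, h) \<Rightarrow>
       (case trans M q (tape h) of (q', s', m) \<Rightarrow> (q', tape(h := s'), shift m h)))"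

definition initial :: "'a tm \<Rightarrow> 'a list \<Rightarrow> 'a config" where
  "initial M w =
    (start M, (\<lambda>i. if 0 \<le> i \<and> i < int (length w) then Letter (w ! nat i) else Blank), 0)"

definition halts_within :: "'a tm \<Rightarrow> 'a list \<Rightarrow> nat \<Rightarrow> bool" where
  "halts_within M w n \<longleftrightarrow> halting M ((step M ^^ n) (initial M w))"

definition accepts :: "'a tm \<Rightarrow> 'a list \<Rightarrow> bool" where
  "accepts M w \<longleftrightarrow> (\<exists>n. fst ((step M ^^ n) (initial M w)) = acc M)"

text \<open>The decision problem with instances \<open>I\<close> and question \<open>Q\<close>, where
  \<open>enc\<close> writes instances as words. The machine runs in polynomial time on every word;
  it has to answer correctly on encodings of instances.\<close>

definition poly_time_decidable ::
    "('i \<Rightarrow> 'a::finite list) \<Rightarrow> 'i set \<Rightarrow> ('i \<Rightarrow> bool) \<Rightarrow> bool" where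
  "poly_time_decidable enc I Q \<longleftrightarrow>
    (\<exists>(M :: 'a tm) (p :: nat poly). turing_machine M \<and>
      (\<forall>w. halts_within M w (poly p (length w))) \<and>
      (\<forall>x \<in> I. accepts M (enc x) \<longleftrightarrow> Q x))"


section \<open>Encoding of the input\<close>

datatype letter = Bit bool | Comma | Semicolon

instance letter :: finite
proof
  have "(UNIV :: letter set) \<subseteq> insert Comma (insert Semicolon (range Bit))"
    using letter.exhaust by blast
  then show "finite (UNIV :: letter set)" by (rule finite_subset) simp
qed

text \<open>Binary notation without leading zeros, most significant bit first.\<close>

fun binary :: "nat \<Rightarrow> letter list" where
  "binary n = (if n = 0 then [] else binary (n div 2) @ [Bit (odd n)])"

declare binary.simps [simp del]

definition encode_partition :: "nat list \<Rightarrow> letter list" where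
  "encode_partition xs = concat (map (\<lambda>k. binary k @ [Comma]) xs)"

definition encode_triple :: "nat list \<times> nat list \<times> nat list \<Rightarrow> letter list" where
  "encode_triple = (\<lambda>(lam, \<mu>, \<pi>).
    encode_partition lam @ [Semicolon] @ encode_partition \<mu> @ [Semicolon] @ encode_partition \<pi>)"

end

theory Submission imports Defs begin

text \<open>If every entry of the three marginals is at most \<open>c\<close> and \<open>n = |\<lambda>|\<close> exceeds \<open>2 c\<^sup>2\<close>, then a
  point set always exists. Match the cells of the diagrams of \<open>\<lambda>\<close>, \<open>\<mu>\<close>, \<open>\<pi>\<close> by bijections and send
  each matched triple of cells to its triple of column indices; this gives the right marginals as
  soon as distinct triples of cells give distinct points. A cell whose first two column indices
  occur twice is repaired by exchanging its partner with that of another cell, and at most \<open>2 c\<^sup>2\<close>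
  cells are unsuitable for the exchange. Hence for fixed \<open>c\<close> only finitely many instances have a
  negative answer, and a machine can look them up.\<close>

section \<open>Matchings without repeated labels\<close>

text \<open>Bounds the elements unsuitable for an exchange: at most \<open>c\<close> forbidden
  labels, each carried by at most \<open>c\<close> elements.\<close>

lemma card_fibres_le:
  assumes "card S \<le> c" and "finite S"
    and "\<And>i. card {a \<in> A. f a = i} \<le> c"
  shows "card {a \<in> A. f a \<in> S} \<le> c * c"
proof -
  have "{a \<in> A. f a \<in> S} = (\<Union>i\<in>S. {a \<in> A. f a = i})" by blast
  then have "card {a \<in> A. f a \<in> S} \<le> (\<Sum>i\<in>S. card {a \<in> A. f a = i})"
    using card_UN_le[OF \<open>finite S\<close>, of "\<lambda>i. {a \<in> A. f a = i}"] by simp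
  also have "\<dots> \<le> card S * c"
    using assms(3) sum_bounded_above[of S "\<lambda>i. card {a \<in> A. f a = i}" c] by simp
  also have "\<dots> \<le> c * c" using assms(1) by simp
  finally show ?thesis .
qed

lemma card_fibre_bij_betw:
  assumes "bij_betw f A B"
  shows "card {a \<in> A. h (f a) = i} = card {b \<in> B. h b = i}"
proof -
  have "f ` {a \<in> A. h (f a) = i} = {b \<in> B. h b = i}"
    using assms by (auto simp: bij_betw_def)
  moreover have "inj_on f {a \<in> A. h (f a) = i}"
    using assms by (auto simp: bij_betw_def intro: inj_on_subset)
  ultimately show ?thesis by (metis card_image)
qed

text \<open>Induction on the size of \<open>bad f\<close>, which is empty exactly when all label
  pairs are distinct. Exchanging the values of \<open>f\<close> at a bad \<open>d\<close> and a
  suitable \<open>e\<close> cures \<open>d\<close> and creates no new bad element.\<close>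

lemma ex_bij_betw_inj_on_pair:
  fixes u :: "'a \<Rightarrow> 'c" and v :: "'b \<Rightarrow> 'd"
  assumes "finite A" and "finite B" and card: "card A = card B" and large: "2 * c * c < card A"
    and u: "\<And>i. card {a \<in> A. u a = i} \<le> c" and v: "\<And>i. card {b \<in> B. v b = i} \<le> c"
  shows "\<exists>f. bij_betw f A B \<and> inj_on (\<lambda>a. (u a, v (f a))) A"
proof -
  define bad where
    "bad f = {a \<in> A. \<exists>a' \<in> A. a' \<noteq> a \<and> u a' = u a \<and> v (f a') = v (f a)}" for f
  have repair: "\<exists>f. bij_betw f A B \<and> bad f = {}" if "bij_betw f A B" for f
    using that
  proof (induction "card (bad f)" arbitrary: f rule: less_induct)
    case less
    show ?case
    proof (cases "bad f = {}")
      case True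
      then show ?thesis using less.prems by blast
    next
      case False
      then obtain d where d: "d \<in> bad f" by blast
      then have dA: "d \<in> A" by (simp add: bad_def)
      have fibre: "card {a \<in> A. v (f a) = i} \<le> c" for i
        using v[of i] card_fibre_bij_betw[OF less.prems, of v i] by simp
      \<comment> \<open>\<open>S\<close> collects the second labels already paired with
        \<open>u d\<close>, and \<open>T\<close> the first labels already paired with
        \<open>v (f d)\<close>. If \<open>v (f e)\<close> avoids \<open>S\<close> and
        \<open>u e\<close> avoids \<open>T\<close>, the exchange gives \<open>d\<close> and
        \<open>e\<close> pairs that nothing else has.\<close>
      define S where "S = (\<lambda>a. v (f a)) ` {a \<in> A. u a = u d}"
      define T where "T = u ` {a \<in> A. v (f a) = v (f d)}"
      have small: "card S \<le> c" "finite S" "card T \<le> c" "finite T"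
        unfolding S_def T_def using \<open>finite A\<close> u[of "u d"] fibre[of "v (f d)"]
        by (auto intro: order_trans[OF card_image_le])
      have "card {a \<in> A. v (f a) \<in> S} \<le> c * c" "card {a \<in> A. u a \<in> T} \<le> c * c"
        using card_fibres_le[OF small(1,2) fibre]
          card_fibres_le[OF small(3,4) u] by simp_all
      then have "card ({a \<in> A. v (f a) \<in> S} \<union> {a \<in> A. u a \<in> T}) < card A"
        using card_Un_le[of "{a \<in> A. v (f a) \<in> S}" "{a \<in> A. u a \<in> T}"] large by linarith
      then have "{a \<in> A. v (f a) \<in> S} \<union> {a \<in> A. u a \<in> T} \<noteq> A" by auto
      then obtain e where e: "e \<in> A" "v (f e) \<notin> S" "u e \<notin> T" by blast
      have vS: "v (f a) \<noteq> v (f e)" if "a \<in> A" "u a = u d" for a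
      proof -
        have "v (f a) \<in> S" using that unfolding S_def by blast
        then show ?thesis using e(2) by metis
      qed
      have uT: "u a \<noteq> u e" if "a \<in> A" "v (f a) = v (f d)" for a
      proof -
        have "u a \<in> T" using that unfolding T_def by blast
        then show ?thesis using e(3) by metis
      qed
      define g where "g = f(d := f e, e := f d)"
      have ed: "e \<noteq> d" using vS dA by blast
      have inj: "inj_on f A" and im: "f ` A = B"
        using less.prems by (simp_all add: bij_betw_def)
      have g_inj: "inj_on g A"
      proof (rule inj_onI)
        fix a b assume "a \<in> A" "b \<in> A" "g a = g b"
        then show "a = b"
          using dA e(1) inj_onD[OF inj, of a b] inj_onD[OF inj, of a d] inj_onD[OF inj, of a e]
            inj_onD[OF inj, of d b] inj_onD[OF inj, of e b] inj_onD[OF inj, of d e]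
          by (auto simp: g_def split: if_splits)
      qed
      have "g ` A \<subseteq> B"
        using im dA e(1) by (auto simp: g_def)
      then have "g ` A = B"
        using card_image[OF g_inj] card \<open>finite B\<close> by (intro card_subset_eq) simp_all
      with g_inj have bij: "bij_betw g A B" by (simp add: bij_betw_def)
      \<comment> \<open>No other element shares the new pair of \<open>d\<close> or of
        \<open>e\<close>, so a clash under \<open>g\<close> involves neither. Away from them
        \<open>g\<close> agrees with \<open>f\<close>, so it is a clash under
        \<open>f\<close>.\<close>
      have "bad g \<subseteq> bad f - {d}"
      proof
        fix a assume "a \<in> bad g"
        then obtain a' where a: "a \<in> A" "a' \<in> A" "a' \<noteq> a" "u a' = u a" "v (g a') = v (g a)"
          unfolding bad_def by blast
        have nd: "False" if "b \<in> A" "b \<noteq> d" "u b = u d" "v (g b) = v (g d)" for b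
          using that vS[of b] uT[of d] dA ed unfolding g_def by (auto split: if_splits)
        have ne: "False" if "b \<in> A" "b \<noteq> e" "u b = u e" "v (g b) = v (g e)" for b
          using that uT[of b] uT[of d] dA ed unfolding g_def by (auto split: if_splits)
        have "a \<noteq> d" "a' \<noteq> d" "a \<noteq> e" "a' \<noteq> e"
          using a nd[of a] nd[of a'] ne[of a] ne[of a'] by metis+
        then show "a \<in> bad f - {d}"
          using a unfolding bad_def g_def by auto
      qed
      moreover have "finite (bad f)" using \<open>finite A\<close> by (simp add: bad_def)
      ultimately have "card (bad g) < card (bad f)"
        using d by (intro psubset_card_mono) auto
      then show ?thesis using less.hyps bij by blast
    qed
  qed
  obtain f0 where "bij_betw f0 A B"
    using finite_same_card_bij[OF \<open>finite A\<close> \<open>finite B\<close> card] by blast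
  from repair[OF this] obtain f where "bij_betw f A B" "bad f = {}" by blast
  then show ?thesis unfolding bad_def inj_on_def by blast
qed

section \<open>Large instances\<close>

definition diagram :: "nat list \<Rightarrow> (nat \<times> nat) set" where
  "diagram xs = (SIGMA j:{..<length xs}. {..<xs ! j})"

lemma finite_diagram: "finite (diagram xs)"
  by (simp add: diagram_def)

lemma card_diagram: "card (diagram xs) = sum_list xs"
  by (simp add: diagram_def card_SigmaI sum_list_sum_nth atLeast0LessThan)

lemma card_diagram_column: "card {d \<in> diagram xs. snd d = i} = column_lengths xs i"
proof -
  have "{d \<in> diagram xs. snd d = i} = (\<lambda>j. (j, i)) ` {j. j < length xs \<and> i < xs ! j}"
    by (auto simp: diagram_def)
  then show ?thesis
    by (simp add: column_lengths_def card_image inj_on_def)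
qed

text \<open>A column has at most one cell in each row, and only nonzero rows have cells.\<close>

lemma column_lengths_le_ht: "column_lengths xs i \<le> ht xs"
  unfolding column_lengths_def ht_def length_filter_conv_card
  by (intro card_mono) auto

lemma t_coeff_pos:
  assumes sum: "sum_list lam = sum_list \<mu>" "sum_list \<mu> = sum_list \<pi>"
    and ht: "ht lam \<le> c" "ht \<mu> \<le> c" and large: "2 * c * c < sum_list lam"
  shows "t_coeff lam \<mu> \<pi> > 0"
proof -
  let ?A = "diagram lam"
  have "card {d \<in> diagram lam. snd d = i} \<le> c" "card {d \<in> diagram \<mu>. snd d = i} \<le> c" for i
    using ht column_lengths_le_ht[of lam i] column_lengths_le_ht[of \<mu> i]
    by (simp_all add: card_diagram_column)
  then obtain f where f: "bij_betw f ?A (diagram \<mu>)"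
    and inj: "inj_on (\<lambda>d. (snd d, snd (f d))) ?A"
    using ex_bij_betw_inj_on_pair[of ?A "diagram \<mu>" c snd snd] sum large
    by (auto simp: finite_diagram card_diagram)
  \<comment> \<open>Any bijection serves for the third coordinate, since the first two already
    separate the points.\<close>
  obtain g where g: "bij_betw g ?A (diagram \<pi>)"
    using finite_same_card_bij[OF finite_diagram finite_diagram, of lam \<pi>] sum
    by (auto simp: card_diagram)
  define h where "h d = (snd d, snd (f d), snd (g d))" for d
  have "inj_on h ?A"
    using inj unfolding h_def inj_on_def by auto
  \<comment> \<open>Injectivity of \<open>h\<close> turns counting points into counting cells, so
    each marginal becomes a column count.\<close>
  then have marginal: "card {p \<in> h ` ?A. k p = i} = card {d \<in> ?A. k (h d) = i}"
    for k :: "nat \<times> nat \<times> nat \<Rightarrow> nat" and i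
    by (intro card_fibre_bij_betw[symmetric]) (simp add: bij_betw_def)
  have "h ` ?A \<in> point_sets lam \<mu> \<pi>"
    using card_fibre_bij_betw[OF f, of snd] card_fibre_bij_betw[OF g, of snd]
    unfolding point_sets_def marginal_x_def marginal_y_def marginal_z_def
    by (auto simp: marginal card_diagram_column finite_diagram fun_eq_iff)
      (simp_all add: h_def card_diagram_column)
  then show ?thesis
    unfolding t_coeff_def using finite_point_sets card_gt_0_iff by blast
qed

section \<open>Injectivity of the encoding\<close>

text \<open>Digits are never separators, so the first separator in a word ends its first
  block.\<close>

lemma set_binary: "set (binary n) \<subseteq> range Bit"
proof (induction n rule: less_induct)
  case (less n)
  then show ?case by (cases "n = 0") (auto simp: binary.simps[of 0] binary.simps[of n])
qed

text \<open>The last letter gives the parity and the letters before it encode the half; only 0 has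
  the empty word.\<close>

lemma binary_inject: "binary m = binary n \<Longrightarrow> m = n"
proof (induction m arbitrary: n rule: less_induct)
  case (less m)
  show ?case
  proof (cases "m = 0 \<or> n = 0")
    case True
    then show ?thesis
      using less.prems by (auto simp: binary.simps[of m] binary.simps[of n] split: if_splits)
  next
    case False
    then have "binary (m div 2) = binary (n div 2)" "odd m = odd n"
      using less.prems by (auto simp: binary.simps[of m] binary.simps[of n])
    then have "m div 2 = n div 2" "odd m = odd n"
      using less.IH[of "m div 2" "n div 2"] False by auto
    then show ?thesis by (metis div_mod_decomp odd_iff_mod_2_eq_one parity_cases)
  qed
qed

text \<open>Both decompositions cut the word at its first \<open>s\<close>.\<close>

lemma append_Cons_cancel_notin:
  assumes "xs @ s # ys = xs' @ s # ys'" and "s \<notin> set xs" and "s \<notin> set xs'"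
  shows "xs = xs' \<and> ys = ys'"
  using assms by (auto simp: append_eq_append_conv2 append_eq_Cons_conv Cons_eq_append_conv)

lemma encode_partition_inject: "encode_partition xs = encode_partition ys \<Longrightarrow> xs = ys"
proof (induction xs arbitrary: ys)
  case Nil
  then show ?case by (cases ys) (auto simp: encode_partition_def)
next
  case (Cons x xs)
  then obtain y ys' where ys: "ys = y # ys'"
    by (cases ys) (auto simp: encode_partition_def)
  have "binary x @ Comma # encode_partition xs = binary y @ Comma # encode_partition ys'"
    using Cons.prems ys by (simp add: encode_partition_def)
  then have "binary x = binary y \<and> encode_partition xs = encode_partition ys'"
    by (rule append_Cons_cancel_notin) (use set_binary in blast)+
  then show ?case using ys Cons.IH binary_inject by blast
qed

lemma Semicolon_notin_encode_partition: "Semicolon \<notin> set (encode_partition xs)"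
  unfolding encode_partition_def by (auto dest!: subsetD[OF set_binary])

text \<open>The lookup table holds words; by injectivity a listed word comes from one triple
  only.\<close>

lemma inj_encode_triple: "inj encode_triple"
proof (rule injI)
  fix x y assume eq: "encode_triple x = encode_triple y"
  obtain a b c a' b' c' where xy: "x = (a, b, c)" "y = (a', b', c')"
    by (metis prod_cases3)
  have "encode_partition a @ Semicolon # encode_partition b @ Semicolon # encode_partition c =
      encode_partition a' @ Semicolon # encode_partition b' @ Semicolon # encode_partition c'"
    using eq xy by (simp add: encode_triple_def)
  then show "x = y"
    using xy append_Cons_cancel_notin Semicolon_notin_encode_partition encode_partition_inject
    by metis
qed

section \<open>Lookup in a finite table\<close>

lemma step_halting: "halting M C \<Longrightarrow> (step M ^^ n) C = C"
  by (induction n) (simp_all add: step_def)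

text \<open>Halting configurations are fixed points of \<open>step M\<close>, so the state after
  \<open>n\<close> steps is final.\<close>

lemma accepts_iff_if_halts_within:
  assumes "halts_within M w n"
  shows "accepts M w \<longleftrightarrow> fst ((step M ^^ n) (initial M w)) = acc M"
proof -
  have stable: "(step M ^^ l) (initial M w) = (step M ^^ k) (initial M w)"
    if "halts_within M w k" "k \<le> l" for k l
  proof -
    have "(step M ^^ l) (initial M w) = (step M ^^ (l - k)) ((step M ^^ k) (initial M w))"
      using that(2) by (metis comp_apply funpow_add le_add_diff_inverse2)
    then show ?thesis using that(1) by (simp add: halts_within_def step_halting)
  qed
  have "fst ((step M ^^ n) (initial M w)) = acc M"
    if "fst ((step M ^^ m) (initial M w)) = acc M" for m
  proof (cases "m \<le> n")
    case True
    then show ?thesis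
      using that stable[of m n] by (simp add: halts_within_def halting_def)
  next
    case False
    then show ?thesis using that stable[of n m] assms by simp
  qed
  then show ?thesis unfolding accepts_def by blast
qed

text \<open>The machine keeps the prefix read so far in its state, as long as this prefix is no longer than
  the longest word of the table.\<close>

lemma poly_time_decidable_cofinite:
  fixes enc :: "'i \<Rightarrow> 'a::finite list"
  assumes "finite B" and correct: "\<And>x. x \<in> I \<Longrightarrow> Q x \<longleftrightarrow> enc x \<notin> B"
  shows "poly_time_decidable enc I Q"
proof -
  obtain L where L: "\<And>w. w \<in> B \<Longrightarrow> length w \<le> L"
    using finite_maxlen[OF \<open>finite B\<close>] by (meson less_imp_le)
  define S where "S = {u :: 'a list. length u \<le> L}"
  have "finite S"
    using finite_lists_length_le[of "UNIV :: 'a set" L] by (simp add: S_def)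
  then obtain e :: "'a list \<Rightarrow> nat" where e: "inj_on e S"
    using finite_imp_inj_to_nat_seg by blast
  \<comment> \<open>The shift by two reserves the numbers 0 and 1 for the accepting and the
    rejecting state.\<close>
  define st where "st u = Suc (Suc (e u))" for u
  define dec where "dec q = inv_into S e (q - 2)" for q
  have dec: "dec (st u) = u" if "u \<in> S" for u
    using e that by (simp add: dec_def st_def)
  \<comment> \<open>A letter following a prefix of length \<open>L\<close> makes the word too long
    for \<open>B\<close>, so the machine accepts at once. A blank marks the end of the input, where
    the table is consulted.\<close>
  define tr :: "nat \<Rightarrow> 'a tape_symbol \<Rightarrow> nat \<times> 'a tape_symbol \<times> move" where
    "tr q s = (case s of
        Letter a \<Rightarrow> (if length (dec q) < L then st (dec q @ [a]) else 0, s, Move_Right)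
      | _ \<Rightarrow> (if dec q \<in> B then 1 else 0, s, Stay))" for q s
  define M :: "'a tm" where
    "M = \<lparr>states = {0, 1} \<union> st ` S, alphabet = insert Blank (range Letter), trans = tr,
      start = st [], acc = 0, rej = 1\<rparr>"
  have sel [simp]: "start M = st []" "acc M = 0" "rej M = 1" "trans M = tr"
    by (simp_all add: M_def)
  have step_M: "step M (q, t, h) = (if q = 0 \<or> q = 1 then (q, t, h)
      else case tr q (t h) of (q', s, m) \<Rightarrow> (q', t(h := s), shift m h))" for q t h
    by (simp add: step_def halting_def)
  have stay_0: "fst (step M C) = 0" if "fst C = 0" for C
    using that by (simp add: step_def halting_def)
  have "turing_machine M"
    unfolding turing_machine_def M_def using \<open>finite S\<close>
    by (auto simp: tr_def S_def dec)
  \<comment> \<open>One step for each letter and one at the blank behind the word.\<close>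
  moreover have run: "fst ((step M ^^ Suc (length w)) (initial M w)) = (if w \<in> B then 1 else 0)"
    for w
  proof -
    let ?tape = "fst (snd (initial M w))"
    have tape: "?tape (int k) = (if k < length w then Letter (w ! k) else Blank)" for k
      by (simp add: initial_def)
    \<comment> \<open>Up to length \<open>L\<close> the state stores the prefix read and the tape is
      unchanged; beyond that the machine has accepted. The change happens in the step from
      \<open>k = L\<close>.\<close>
    have pref: "if k \<le> L then (step M ^^ k) (initial M w) = (st (take k w), ?tape, int k)
        else fst ((step M ^^ k) (initial M w)) = 0" if "k \<le> length w" for k
      using that
    proof (induction k)
      case 0
      then show ?case by (simp add: initial_def)
    next
      case (Suc k)
      show ?case
      proof (cases "k \<le> L")
        case True
        then have "(step M ^^ k) (initial M w) = (st (take k w), ?tape, int k)"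
          using Suc by simp
        moreover have "dec (st (take k w)) = take k w"
          using True Suc.prems by (intro dec) (simp add: S_def)
        moreover have "st (take k w) \<noteq> 0" "st (take k w) \<noteq> 1" by (simp_all add: st_def)
        moreover have "k < length w" using Suc.prems by simp
        moreover have "?tape(int k := Letter (w ! k)) = ?tape"
          using tape[of k] \<open>k < length w\<close> by (intro fun_upd_idem) simp
        ultimately show ?thesis
          using tape[of k] True
          by (auto simp: step_M tr_def take_Suc_conv_app_nth stay_0)
      next
        case False
        then have "fst ((step M ^^ k) (initial M w)) = 0" using Suc by simp
        then show ?thesis
          using False by (simp add: stay_0)
      qed
    qed
    show ?thesis
    proof (cases "length w \<le> L")
      case True
      then have "(step M ^^ length w) (initial M w) = (st w, ?tape, int (length w))"
        using pref[of "length w"] by simp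
      moreover have "dec (st w) = w" using True by (intro dec) (simp add: S_def)
      moreover have "st w \<noteq> 0" "st w \<noteq> 1" by (simp_all add: st_def)
      ultimately show ?thesis
        using tape[of "length w"] by (simp add: step_M tr_def)
    next
      case False
      then have "fst ((step M ^^ length w) (initial M w)) = 0" "w \<notin> B"
        using pref[of "length w"] L by auto
      then show ?thesis by (simp add: stay_0)
    qed
  qed
  moreover have halts: "halts_within M w (Suc (length w))" for w
    using run[of w] by (simp add: halts_within_def halting_def del: funpow.simps)
  moreover have "accepts M (enc x) \<longleftrightarrow> Q x" if "x \<in> I" for x
    using accepts_iff_if_halts_within[OF halts] run[of "enc x"] correct[OF that]
    by (simp del: funpow.simps)
  \<comment> \<open>The time bound is the polynomial \<open>X + 1\<close>.\<close>
  moreover have "poly [:1, 1:] (length w) = Suc (length w)" for w :: "'a list"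
    by simp
  ultimately show ?thesis
    unfolding poly_time_decidable_def by metis
qed

section \<open>Finiteness of the negative instances and the decision\<close>

lemma finite_partitions_sum_le: "finite {xs. is_partition xs \<and> sum_list xs \<le> N}"
proof (rule finite_subset)
  show "finite {xs. set xs \<subseteq> {..N} \<and> length xs \<le> N}"
    by (rule finite_lists_length_le) simp
  show "{xs. is_partition xs \<and> sum_list xs \<le> N} \<subseteq> {xs. set xs \<subseteq> {..N} \<and> length xs \<le> N}"
  proof clarify
    fix xs assume xs: "is_partition xs" "sum_list xs \<le> N"
    \<comment> \<open>Positive parts make the sum a bound on the number of parts too.\<close>
    have "0 \<notin> set xs \<Longrightarrow> length xs \<le> sum_list xs"
      by (induction xs) auto
    then show "set xs \<subseteq> {..N} \<and> length xs \<le> N"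
      using xs member_le_sum_list by (fastforce simp: is_partition_def)
  qed
qed

theorem theorem6p4:
  fixes c :: nat
  shows "poly_time_decidable encode_triple
    {(lam, \<mu>, \<pi>). is_partition lam \<and> is_partition \<mu> \<and> is_partition \<pi> \<and>
       sum_list lam = sum_list \<mu> \<and> sum_list \<mu> = sum_list \<pi> \<and>
       ht lam \<le> c \<and> ht \<mu> \<le> c \<and> ht \<pi> \<le> c}
    (\<lambda>(lam, \<mu>, \<pi>). t_coeff lam \<mu> \<pi> > 0)"
  (is "poly_time_decidable _ ?I ?Q")
proof (rule poly_time_decidable_cofinite)
  \<comment> \<open>\<open>2 * c * c\<close> is the threshold of \<open>t_coeff_pos\<close>: above
    it every answer is positive.\<close>
  let ?P = "{xs. is_partition xs \<and> sum_list xs \<le> 2 * c * c}"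
  have "{x \<in> ?I. \<not> ?Q x} \<subseteq> ?P \<times> ?P \<times> ?P"
  proof
    fix x assume x: "x \<in> {x \<in> ?I. \<not> ?Q x}"
    obtain lam \<mu> \<pi> where x_eq: "x = (lam, \<mu>, \<pi>)" by (cases x)
    have *: "is_partition lam" "is_partition \<mu>" "is_partition \<pi>"
      "sum_list lam = sum_list \<mu>" "sum_list \<mu> = sum_list \<pi>" "ht lam \<le> c" "ht \<mu> \<le> c"
      and "\<not> t_coeff lam \<mu> \<pi> > 0"
      using x by (simp_all add: x_eq)
    then have "\<not> 2 * c * c < sum_list lam" using t_coeff_pos by metis
    then show "x \<in> ?P \<times> ?P \<times> ?P" using * by (simp add: x_eq)
  qed
  then have "finite {x \<in> ?I. \<not> ?Q x}"
    using finite_partitions_sum_le by (meson finite_SigmaI finite_subset)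
  then show "finite (encode_triple ` {x \<in> ?I. \<not> ?Q x})" by simp
  show "?Q x \<longleftrightarrow> encode_triple x \<notin> encode_triple ` {x \<in> ?I. \<not> ?Q x}" if "x \<in> ?I" for x
    using that by (simp add: inj_image_mem_iff[OF inj_encode_triple])
qed

end
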